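(* Let $n\geq 1$ and let $u=u_1u_2\cdots u_{2n}$ be an alternating permutation in $A_{2n}(4312)$ with label $(a,b)$. If $u$ is an internal vertex, then $u$ generates $\binom{b-a+1}{2}$ leaves (that is, exactly $\binom{b-a+1}{2}$ of its children are leaves), and the set of labels of the internal vertices generated by $u$ (that is, of the children of $u$ that are internal vertices) is $$\{(x,y)\,|\,2\leq x\leq a+1,\ a+2\leq y\leq b+2\}.$$
   Context: A permutation $\pi=\pi_1\pi_2\cdots\pi_m$ of $[m]=\{1,2,\ldots,m\}$ is alternating if $\pi_1<\pi_2>\pi_3<\pi_4>\cdots$. A permutation contains a pattern $\sigma\in S_k$ if it has a subsequence order isomorphic to $\sigma$; otherwise it avoids $\sigma$. $A_m(\sigma)$ denotes the set of alternating permutations of $[m]$ that avoid $\sigma$. Children: for $m\ge1$ and $u\in A_{2m}(4312)$, a child of $u$ (a permutation generated by $u$) is a permutation $w=w_1w_2\cdots w_{2m+2}\in A_{2m+2}(4312)$ such that $w_3w_4\cdots w_{2m+2}$ is order isomorphic to $u$. A permutation $u\in A_{2m}(4312)$ is a leaf if it has no children, and an internal vertex if it has at least one child. For $m\geq 1$ and $u=u_1\cdots u_{2m}\in A_{2m}(4312)$, define $$g(u)=\min\{2m+1,\,u_i\,|\,\text{there exist } j \text{ and } k \text{ such that } i<j<k \text{ and } u_j<u_k<u_i\},$$ $$h(u)=\min\{2m+1,\,u_j\,|\,\text{there exists } i \text{ such that } i<j \text{ and } u_i<u_j\}.$$ The label of $u$ is $(0,0)$ if $u$ is a leaf, and $(h(u),g(u))$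 if $u$ is an internal vertex. The same definitions with $m=n+1$ give the labels of the children of $u\in A_{2n}(4312)$. *)

theory Defs
  imports
    Main
    "HOL-Library.Sublist"
    "HOL-Combinatorics.Multiset_Permutations"
begin

text \<open>
  A permutation of \<open>[m]\<close> is written in one-line notation, as a list of naturals lying in
  \<open>permutations_of_set {1..m}\<close>.  List positions start at 0, so the entry \<open>\<pi>\<^sub>i\<close> is \<open>xs ! (i - 1)\<close>;
  the values themselves are \<open>1, \<dots>, m\<close>.
\<close>

definition order_isomorphic :: "nat list \<Rightarrow> nat list \<Rightarrow> bool" where
  "order_isomorphic xs ys \<longleftrightarrow> length xs = length ys \<and>
     (\<forall>i<length xs. \<forall>j<length xs. xs ! i < xs ! j \<longleftrightarrow> ys ! i < ys ! j)"

definition contains_pattern :: "nat list \<Rightarrow> nat list \<Rightarrow> bool" where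
  "contains_pattern xs \<sigma> \<longleftrightarrow> (\<exists>ys. subseq ys xs \<and> order_isomorphic ys \<sigma>)"

text \<open>The ascents of an alternating permutation are at the even list positions \<open>0, 2, 4, \<dots>\<close>.\<close>

definition alternating :: "nat list \<Rightarrow> bool" where
  "alternating xs \<longleftrightarrow> (\<forall>i. Suc i < length xs \<longrightarrow>
     (if even i then xs ! i < xs ! Suc i else xs ! i > xs ! Suc i))"

definition alt_avoid :: "nat \<Rightarrow> nat list \<Rightarrow> nat list set" where
  "alt_avoid m \<sigma> =
     {xs \<in> permutations_of_set {1..m}. alternating xs \<and> \<not> contains_pattern xs \<sigma>}"

text \<open>
  The notions below are meant for \<open>u \<in> alt_avoid (2 * m) [4, 3, 1, 2]\<close> with \<open>m \<ge> 1\<close>; the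
  parameter \<open>2 * m\<close> is recovered as \<open>length u\<close>.
\<close>

definition children :: "nat list \<Rightarrow> nat list set" where
  "children u =
     {w \<in> alt_avoid (length u + 2) [4, 3, 1, 2]. order_isomorphic (drop 2 w) u}"

definition leaf :: "nat list \<Rightarrow> bool" where
  "leaf u \<longleftrightarrow> children u = {}"

definition internal_vertex :: "nat list \<Rightarrow> bool" where
  "internal_vertex u \<longleftrightarrow> children u \<noteq> {}"

definition g :: "nat list \<Rightarrow> nat" where
  "g u = Min (insert (length u + 1)
     {u ! i | i. \<exists>j k. i < j \<and> j < k \<and> k < length u \<and> u ! j < u ! k \<and> u ! k < u ! i})"

definition h :: "nat list \<Rightarrow> nat" where
  "h u = Min (insert (length u + 1)
     {u ! j | j. j < length u \<and> (\<exists>i<j. u ! i < u ! j)})"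

definition label :: "nat list \<Rightarrow> nat \<times> nat" where
  "label u = (if leaf u then (0, 0) else (h u, g u))"

text \<open>
  Hence in any label \<open>(a, b)\<close> we have \<open>a \<le> b\<close>, and the difference \<open>b - a\<close> on naturals is the
  true one.
\<close>

lemma h_le_g: "h u \<le> g u"
proof -
  let ?G = "{u ! i | i. \<exists>j k. i < j \<and> j < k \<and> k < length u \<and> u ! j < u ! k \<and> u ! k < u ! i}"
  let ?H = "{u ! j | j. j < length u \<and> (\<exists>i<j. u ! i < u ! j)}"
  have "?G \<subseteq> set u" "?H \<subseteq> set u"
    by auto
  then have fin: "finite ?G" "finite ?H"
    by (auto intro: finite_subset)
  have "h u \<le> x" if x: "x \<in> insert (length u + 1) ?G" for x
  proof (cases "x = length u + 1")
    case True
    then show ?thesis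
      using fin by (simp add: h_def)
  next
    case False
    then obtain j k where "j < k" "k < length u" "u ! j < u ! k" "u ! k < x"
      using x by auto
    moreover from this have "u ! k \<in> ?H"
      by blast
    then have "h u \<le> u ! k"
      unfolding h_def using fin by (intro Min_le) auto
    ultimately show ?thesis
      by simp
  qed
  then show ?thesis
    unfolding g_def using fin by (subst Min_ge_iff) auto
qed

end

theory Submission
  imports Defs
begin

text \<open>
  A child of \<open>u\<close> is determined by its first two entries \<open>p < q\<close>: the rest must be \<open>u\<close> relabelled
  increasingly by the values other than \<open>p\<close> and \<open>q\<close>.  A new occurrence of 4312 uses \<open>p\<close> or \<open>q\<close> as
  its 4, since \<open>p < q\<close> keeps them from being its 4 and 3 together; and \<open>q\<close> serves whenever \<open>p\<close>
  does.  So the word is a child exactly when \<open>q\<close> exceeds the relabelled first entry of \<open>u\<close> and stays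
  below every relabelled head of a 312 in \<open>u\<close>, that is when \<open>hd u + 2 \<le> q \<le> g u + 1\<close>
  (\<open>children_eq\<close>).  In particular \<open>u\<close> is a leaf exactly when \<open>g u \<le> hd u\<close> (\<open>leaf_iff\<close>).

  Let \<open>u\<close> be internal with label \<open>(a, b)\<close>.  Then \<open>hd u < a\<close>: a smaller ascent top would make the
  first entry the head of a 312.  The word \<open>p q \<dots>\<close> gains \<open>p\<close> as a head of a 312 if \<open>a < p\<close>, and
  gains \<open>q\<close> if \<open>a + 1 < q\<close>.  If \<open>a < p\<close>, then \<open>g\<close> takes the value \<open>p\<close>, the child's first
  entry, and the child is a leaf; the lower bound on \<open>q\<close> is then automatic, so the leaves are the pairs
  \<open>a < p < q \<le> b + 1\<close>, chosen among \<open>b + 1 - a\<close> values.  If \<open>p \<le> a\<close>, then \<open>g\<close> is \<open>q\<close> or the shifted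
  \<open>b + 2\<close>, both larger than \<open>p\<close>, so the child is internal; and \<open>h\<close> is \<open>p + 1\<close>, because every
  value above \<open>p\<close> becomes an ascent top (\<open>h_prepend\<close>, \<open>g_prepend\<close>).  For each \<open>p \<le> a\<close> all
  \<open>q\<close> from \<open>a + 2\<close> to \<open>b + 1\<close> occur, and \<open>q = a + 1\<close> produces the remaining second
  coordinate \<open>b + 2\<close>.
\<close>

\<comment> \<open>The pattern occurs as the literal \<open>[4, 3, 1, 2]\<close>, which rewriting \<open>1\<close> to \<open>Suc 0\<close> would destroy.\<close>
declare One_nat_def [simp del]

section \<open>The patterns 12, 312 and 4312 by recursion on the list\<close>

text \<open>
  The two sets whose minima are \<open>h\<close> and \<open>g\<close>, phrased with subsequences instead of positions so
  that they obey recursion equations in \<open>(#)\<close>; prepending two entries then becomes a computation.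
\<close>
definition ascent_tops :: "nat list \<Rightarrow> nat set" where
  "ascent_tops xs = {y. \<exists>x<y. subseq [x, y] xs}"

definition heads_312 :: "nat list \<Rightarrow> nat set" where
  "heads_312 xs = {x. \<exists>y z. subseq [x, y, z] xs \<and> y < z \<and> z < x}"

lemma subseq_Cons_Cons_iff:
  "subseq (a # as) (x # xs) \<longleftrightarrow> (a = x \<and> subseq as xs) \<or> subseq (a # as) xs"
  by (cases "a = x") (auto dest: subseq_Cons')

lemma subseq_Cons_iff_nth:
  "subseq (a # as) xs \<longleftrightarrow> (\<exists>i<length xs. xs ! i = a \<and> subseq as (drop (Suc i) xs))"
proof (induction xs)
  case (Cons x xs)
  show ?case
    unfolding subseq_Cons_Cons_iff Cons.IH by (auto simp: Ex_less_Suc2)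
qed simp

lemma subseq_pair_iff_nth:
  "subseq [x, y] xs \<longleftrightarrow> (\<exists>i j. i < j \<and> j < length xs \<and> xs ! i = x \<and> xs ! j = y)"
proof
  assume "subseq [x, y] xs"
  then obtain i k where "i < length xs" "xs ! i = x" "k < length xs - Suc i"
    "drop (Suc i) xs ! k = y"
    by (auto simp: subseq_Cons_iff_nth)
  then show "\<exists>i j. i < j \<and> j < length xs \<and> xs ! i = x \<and> xs ! j = y"
    by (intro exI[of _ i] exI[of _ "Suc i + k"]) auto
next
  assume "\<exists>i j. i < j \<and> j < length xs \<and> xs ! i = x \<and> xs ! j = y"
  then obtain i j where ij: "i < j" "j < length xs" "xs ! i = x" "xs ! j = y"
    by blast
  then have "drop (Suc i) xs ! (j - Suc i) = y" "j - Suc i < length (drop (Suc i) xs)"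
    by auto
  then have "y \<in> set (drop (Suc i) xs)"
    by (metis nth_mem)
  then show "subseq [x, y] xs"
    unfolding subseq_Cons_iff_nth[of x] subseq_singleton_left
    using ij by (intro exI[of _ i]) auto
qed

lemma subseq_triple_iff_nth:
  "subseq [x, y, z] xs \<longleftrightarrow>
    (\<exists>i j k. i < j \<and> j < k \<and> k < length xs \<and> xs ! i = x \<and> xs ! j = y \<and> xs ! k = z)"
proof
  assume "subseq [x, y, z] xs"
  then obtain i j k where "i < length xs" "xs ! i = x" "j < k" "k < length xs - Suc i"
    "drop (Suc i) xs ! j = y" "drop (Suc i) xs ! k = z"
    unfolding subseq_Cons_iff_nth[of x] subseq_pair_iff_nth by auto
  then show
    "\<exists>i j k. i < j \<and> j < k \<and> k < length xs \<and> xs ! i = x \<and> xs ! j = y \<and> xs ! k = z"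
    by (intro exI[of _ i] exI[of _ "Suc i + j"] exI[of _ "Suc i + k"]) auto
next
  assume "\<exists>i j k. i < j \<and> j < k \<and> k < length xs \<and> xs ! i = x \<and> xs ! j = y \<and> xs ! k = z"
  then obtain i j k where ijk: "i < j" "j < k" "k < length xs"
    "xs ! i = x" "xs ! j = y" "xs ! k = z"
    by blast
  then have "subseq [y, z] (drop (Suc i) xs)"
    unfolding subseq_pair_iff_nth
    by (intro exI[of _ "j - Suc i"] exI[of _ "k - Suc i"]) auto
  then show "subseq [x, y, z] xs"
    unfolding subseq_Cons_iff_nth[of x]
    using ijk by (intro exI[of _ i]) auto
qed

lemma ascent_tops_nth: "ascent_tops xs = {xs ! j | j. j < length xs \<and> (\<exists>i<j. xs ! i < xs ! j)}"
  unfolding ascent_tops_def subseq_pair_iff_nth by blast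

lemma heads_312_nth:
  "heads_312 xs =
    {xs ! i | i. \<exists>j k. i < j \<and> j < k \<and> k < length xs \<and> xs ! j < xs ! k \<and> xs ! k < xs ! i}"
  unfolding heads_312_def subseq_triple_iff_nth by blast

lemma ascent_tops_Nil [simp]: "ascent_tops [] = {}"
  by (simp add: ascent_tops_def)

lemma ascent_tops_Cons: "ascent_tops (x # xs) = ascent_tops xs \<union> {y \<in> set xs. x < y}"
  unfolding ascent_tops_def subseq_Cons_Cons_iff subseq_singleton_left by auto

lemma heads_312_Nil [simp]: "heads_312 [] = {}"
  by (simp add: heads_312_def)

lemma heads_312_Cons:
  "heads_312 (x # xs) = heads_312 xs \<union> {v. v = x \<and> (\<exists>z \<in> ascent_tops xs. z < x)}"
  unfolding heads_312_def ascent_tops_def subseq_Cons_Cons_iff[of _ "[_, _]"] by blast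

lemma ascent_tops_subset: "ascent_tops xs \<subseteq> set xs"
  unfolding ascent_tops_nth by auto

lemma heads_312_subset: "heads_312 xs \<subseteq> set xs"
  unfolding heads_312_nth by auto

lemma finite_ascent_tops [simp]: "finite (ascent_tops xs)"
  by (rule finite_subset[OF ascent_tops_subset]) simp

lemma finite_heads_312 [simp]: "finite (heads_312 xs)"
  by (rule finite_subset[OF heads_312_subset]) simp

lemma h_eq_Min: "h u = Min (insert (length u + 1) (ascent_tops u))"
  by (simp add: h_def ascent_tops_nth)

lemma g_eq_Min: "g u = Min (insert (length u + 1) (heads_312 u))"
  by (simp add: g_def heads_312_nth)

lemma order_isomorphic_4312:
  "order_isomorphic ys [4, 3, 1, 2] \<longleftrightarrow>
    (\<exists>a b c d. ys = [a, b, c, d] \<and> c < d \<and> d < b \<and> b < a)"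
proof
  assume iso: "order_isomorphic ys [4, 3, 1, 2]"
  then have "length ys = 4"
    by (simp add: order_isomorphic_def)
  then obtain a b c d where "ys = [a, b, c, d]"
    by (auto simp: numeral_eq_Suc length_Suc_conv)
  with iso show "\<exists>a b c d. ys = [a, b, c, d] \<and> c < d \<and> d < b \<and> b < a"
    by (simp add: order_isomorphic_def All_less_Suc2)
next
  assume "\<exists>a b c d. ys = [a, b, c, d] \<and> c < d \<and> d < b \<and> b < a"
  then show "order_isomorphic ys [4, 3, 1, 2]"
    by (elim exE conjE) (simp add: order_isomorphic_def All_less_Suc2 not_less)
qed

text \<open>
  An occurrence of 4312 is a 312 preceded by something larger than its head, so knowing the heads is
  enough to extend avoidance by one entry on the left.
\<close>
lemma contains_4312_iff:
  "contains_pattern xs [4, 3, 1, 2] \<longleftrightarrow>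
    (\<exists>a b c d. subseq [a, b, c, d] xs \<and> c < d \<and> d < b \<and> b < a)"
  unfolding contains_pattern_def order_isomorphic_4312 by blast

lemma contains_4312_Cons:
  "contains_pattern (x # xs) [4, 3, 1, 2] \<longleftrightarrow>
    contains_pattern xs [4, 3, 1, 2] \<or> (\<exists>y \<in> heads_312 xs. y < x)"
  unfolding contains_4312_iff heads_312_def subseq_Cons_Cons_iff[of _ "[_, _, _]"] by blast

lemma contains_4312_Nil [simp]: "\<not> contains_pattern [] [4, 3, 1, 2]"
  by (simp add: contains_4312_iff)

lemma ascent_tops_map:
  assumes "strict_mono f"
  shows "ascent_tops (map f xs) = f ` ascent_tops xs"
  by (induction xs) (auto simp: ascent_tops_Cons strict_mono_less[OF assms])

lemma heads_312_map:
  assumes "strict_mono f"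
  shows "heads_312 (map f xs) = f ` heads_312 xs"
  by (induction xs)
    (auto simp: heads_312_Cons ascent_tops_map[OF assms] strict_mono_less[OF assms])

lemma contains_4312_map:
  assumes "strict_mono f"
  shows "contains_pattern (map f xs) [4, 3, 1, 2] \<longleftrightarrow> contains_pattern xs [4, 3, 1, 2]"
  by (induction xs)
    (auto simp: contains_4312_Cons heads_312_map[OF assms] strict_mono_less[OF assms])

section \<open>Prepending two entries to a permutation\<close>

text \<open>For \<open>p < q\<close> this is the increasing enumeration of the naturals other than \<open>p\<close> and \<open>q\<close>.\<close>
definition skip :: "nat \<Rightarrow> nat \<Rightarrow> nat \<Rightarrow> nat" where
  "skip p q v = (if v < p then v else if Suc v < q then v + 1 else v + 2)"

definition prepend :: "nat \<Rightarrow> nat \<Rightarrow> nat list \<Rightarrow> nat list" where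
  "prepend p q u = p # q # map (skip p q) u"

lemma length_prepend [simp]: "length (prepend p q u) = length u + 2"
  by (simp add: prepend_def)

lemma hd_prepend [simp]: "hd (prepend p q u) = p"
  by (simp add: prepend_def)

lemma prepend_inject: "prepend p q u = prepend p' q' u \<longleftrightarrow> p = p' \<and> q = q'"
  by (auto simp: prepend_def)

lemma strict_mono_skip: "strict_mono (skip p q)"
  by (auto simp: strict_mono_def skip_def)

lemma skip_less_iff:
  assumes "p < q"
  shows "skip p q v < p \<longleftrightarrow> v < p" "skip p q v < q \<longleftrightarrow> Suc v < q"
  using assms by (auto simp: skip_def)

text \<open>
  Lets a word built from \<open>u\<close> be a permutation of the right set, and pins down the tail of every child.
\<close>
lemma skip_image:
  assumes "1 \<le> p" "p < q" "q \<le> N + 2"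
  shows "skip p q ` {1..N} = {1..N + 2} - {p, q}"
proof
  show "skip p q ` {1..N} \<subseteq> {1..N + 2} - {p, q}"
    using assms by (auto simp: skip_def)
  show "{1..N + 2} - {p, q} \<subseteq> skip p q ` {1..N}"
  proof
    fix x assume x: "x \<in> {1..N + 2} - {p, q}"
    define v where "v = (if x < p then x else if x < q then x - 1 else x - 2)"
    have "x = skip p q v" "v \<in> {1..N}"
      using x assms by (auto simp: v_def skip_def)
    then show "x \<in> skip p q ` {1..N}"
      by blast
  qed
qed

lemma order_isomorphic_map_strict_mono:
  assumes "strict_mono f"
  shows "order_isomorphic (map f xs) xs"
  by (simp add: order_isomorphic_def strict_mono_less[OF assms])

text \<open>
  The order pattern fixes how many entries lie below the \<open>i\<close>-th one, and within a given finite set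
  an element is determined by the number of elements below it.
\<close>
lemma order_isomorphic_same_set_imp_eq:
  assumes iso: "order_isomorphic xs ys" and set_eq: "set xs = set ys"
    and dist: "distinct xs" "distinct ys"
  shows "xs = ys"
proof (rule nth_equalityI)
  show len: "length xs = length ys"
    using iso by (simp add: order_isomorphic_def)
  fix i assume i: "i < length xs"
  define rank where "rank x = card {v \<in> set xs. v < x}" for x
  have rank_nth: "rank (zs ! i) = card {j. j < length zs \<and> zs ! j < zs ! i}"
    if "distinct zs" "set zs = set xs" for zs
  proof -
    have "{v \<in> set xs. v < zs ! i} = (!) zs ` {j. j < length zs \<and> zs ! j < zs ! i}"
      using that(2) by (auto simp: in_set_conv_nth simp flip: that(2))
    moreover have "inj_on ((!) zs) {j. j < length zs \<and> zs ! j < zs ! i}"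
      using that(1) by (auto intro: inj_on_subset[OF inj_on_nth])
    ultimately show ?thesis
      by (simp add: rank_def card_image)
  qed
  have "{j. j < length xs \<and> xs ! j < xs ! i} = {j. j < length ys \<and> ys ! j < ys ! i}"
    using iso i by (auto simp: order_isomorphic_def)
  then have same_rank: "rank (xs ! i) = rank (ys ! i)"
    using rank_nth dist set_eq by simp
  have rank_less: "rank x < rank y" if "x \<in> set xs" "x < y" for x y
    unfolding rank_def using that by (intro psubset_card_mono) auto
  show "xs ! i = ys ! i"
  proof (rule linorder_cases)
    assume "xs ! i < ys ! i"
    then show ?thesis using rank_less[of "xs ! i"] same_rank i by fastforce
  next
    assume "ys ! i < xs ! i"
    moreover have "ys ! i \<in> set xs" using i len set_eq by simp
    ultimately show ?thesis using rank_less[of "ys ! i"] same_rank by fastforce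
  qed
qed

lemma alternating_Cons_Cons:
  "alternating (p # q # t) \<longleftrightarrow> p < q \<and> (t \<noteq> [] \<longrightarrow> hd t < q) \<and> alternating t"
proof -
  have shift: "(\<forall>i. P i) \<longleftrightarrow> P 0 \<and> P 1 \<and> (\<forall>i. P (Suc (Suc i)))" for P :: "nat \<Rightarrow> bool"
    by (metis One_nat_def not0_implies_Suc)
  show ?thesis
    unfolding alternating_def by (subst shift) (auto simp: hd_conv_nth)
qed

lemma alternating_map:
  assumes "strict_mono f"
  shows "alternating (map f xs) \<longleftrightarrow> alternating xs"
  unfolding alternating_def by (auto simp: strict_mono_less[OF assms])

section \<open>The children of a permutation\<close>

lemma alt_avoid_iff:
  "xs \<in> alt_avoid m [4, 3, 1, 2] \<longleftrightarrow> distinct xs \<and> set xs = {1..m} \<and> alternating xs \<and>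
    \<not> contains_pattern xs [4, 3, 1, 2]"
  by (auto simp: alt_avoid_def permutations_of_set_def)

lemma length_alt_avoid:
  assumes "xs \<in> alt_avoid m [4, 3, 1, 2]"
  shows "length xs = m"
  using assms distinct_card[of xs] by (simp add: alt_avoid_iff)

lemma set_prepend:
  assumes "set u = {1..N}" "1 \<le> p" "p < q" "q \<le> N + 2"
  shows "set (prepend p q u) = {1..N + 2}"
  using assms skip_image[of p q N] by (auto simp: prepend_def)

text \<open>
  The lower bound on \<open>q\<close> is the descent from \<open>q\<close> to the relabelled \<open>hd u\<close>; the upper bound keeps
  \<open>q\<close> from playing the 4.  The offsets differ because a relabelled value below \<open>q\<close> has moved by at
  most one: \<open>v\<close> lands below \<open>q\<close> exactly when \<open>v + 1 < q\<close>.
\<close>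
lemma prepend_in_alt_avoid_iff:
  assumes u: "u \<in> alt_avoid N [4, 3, 1, 2]" "u \<noteq> []"
    and pq: "1 \<le> p" "p < q" "q \<le> N + 2"
  shows "prepend p q u \<in> alt_avoid (N + 2) [4, 3, 1, 2] \<longleftrightarrow> hd u + 2 \<le> q \<and> q \<le> g u + 1"
proof -
  have len: "length u = N"
    using u length_alt_avoid by blast
  have "distinct (prepend p q u)"
  proof -
    have "inj (skip p q)"
      using strict_mono_skip by (rule strict_mono_imp_inj_on)
    then show ?thesis
      using u pq by (auto simp: prepend_def alt_avoid_iff distinct_map skip_def
          split: if_splits intro: inj_on_subset)
  qed
  moreover have "alternating (prepend p q u) \<longleftrightarrow> hd u + 2 \<le> q"
    using u pq skip_less_iff(2)[OF pq(2), of "hd u"]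
    by (auto simp: prepend_def alternating_Cons_Cons alternating_map[OF strict_mono_skip]
        hd_map alt_avoid_iff)
  moreover have "\<not> contains_pattern (prepend p q u) [4, 3, 1, 2] \<longleftrightarrow> q \<le> g u + 1"
  proof -
    have "\<not> contains_pattern (prepend p q u) [4, 3, 1, 2] \<longleftrightarrow>
      (\<forall>y \<in> heads_312 u. \<not> Suc y < q)"
      \<comment> \<open>the entry \<open>p\<close> adds no condition: \<open>q\<close> exceeds it, and a head below \<open>p\<close> is below \<open>q\<close>\<close>
      using u pq
      by (auto simp: prepend_def contains_4312_Cons contains_4312_map[OF strict_mono_skip]
          heads_312_Cons heads_312_map[OF strict_mono_skip] skip_less_iff alt_avoid_iff)
    \<comment> \<open>the default value \<open>length u + 1\<close> in \<open>g\<close> agrees with the bound \<open>q \<le> N + 2\<close>\<close>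
    also have "\<dots> \<longleftrightarrow> q - 1 \<le> g u"
      using pq len by (auto simp: g_eq_Min)
    finally show ?thesis
      by auto
  qed
  moreover have "set (prepend p q u) = {1..N + 2}"
    using u pq by (intro set_prepend) (auto simp: alt_avoid_iff)
  ultimately show ?thesis
    by (simp add: alt_avoid_iff)
qed

lemma g_le: "g u \<le> length u + 1"
  by (simp add: g_eq_Min)

lemma children_eq:
  assumes u: "u \<in> alt_avoid N [4, 3, 1, 2]" "u \<noteq> []"
  shows "children u =
    (\<lambda>(p, q). prepend p q u) ` {(p, q). 1 \<le> p \<and> p < q \<and> hd u + 2 \<le> q \<and> q \<le> g u + 1}"
    (is "_ = ?R")
proof
  have len: "length u = N"
    using u length_alt_avoid by blast
  show "children u \<subseteq> ?R"
  proof
    fix w assume "w \<in> children u"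
    then have w: "w \<in> alt_avoid (N + 2) [4, 3, 1, 2]" and iso: "order_isomorphic (drop 2 w) u"
      by (auto simp: children_def len)
    then obtain p q t where w_eq: "w = p # q # t"
      using length_alt_avoid[OF w] by (metis Suc_length_conv add_2_eq_Suc')
    have pq: "1 \<le> p" "p < q" "q \<le> N + 2" and t: "distinct t" "set t = {1..N + 2} - {p, q}"
      using w by (auto simp: alt_avoid_iff w_eq alternating_Cons_Cons)
    have "t = map (skip p q) u"
    proof (rule order_isomorphic_same_set_imp_eq)
      show "order_isomorphic t (map (skip p q) u)"
        using iso order_isomorphic_map_strict_mono[OF strict_mono_skip, of p q u]
        by (simp add: w_eq order_isomorphic_def)
      show "set t = set (map (skip p q) u)"
        using t u skip_image[OF pq] by (simp add: alt_avoid_iff)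
      show "distinct (map (skip p q) u)"
        using u strict_mono_imp_inj_on[OF strict_mono_skip]
        by (auto simp: distinct_map alt_avoid_iff intro: inj_on_subset)
    qed (fact t)
    then have w_eq': "w = prepend p q u"
      by (simp add: w_eq prepend_def)
    then show "w \<in> ?R"
      using w pq prepend_in_alt_avoid_iff[OF u pq] by auto
  qed
  show "?R \<subseteq> children u"
  proof
    fix w assume "w \<in> ?R"
    then obtain p q where w: "w = prepend p q u"
      and pq: "1 \<le> p" "p < q" "hd u + 2 \<le> q" "q \<le> g u + 1"
      by auto
    then have "w \<in> alt_avoid (N + 2) [4, 3, 1, 2]"
      using prepend_in_alt_avoid_iff[OF u] g_le[of u] len by simp
    then show "w \<in> children u"
      using order_isomorphic_map_strict_mono[OF strict_mono_skip]
      by (simp add: children_def len w prepend_def)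
  qed
qed

text \<open>
  If any \<open>q\<close> is admissible then so is the least one, \<open>hd u + 2\<close>, and \<open>p = 1\<close> goes with it.
\<close>
lemma leaf_iff:
  assumes "u \<in> alt_avoid N [4, 3, 1, 2]" "u \<noteq> []"
  shows "leaf u \<longleftrightarrow> g u \<le> hd u"
proof
  assume "leaf u"
  then have "(1, hd u + 2) \<notin> {(p, q). 1 \<le> p \<and> p < q \<and> hd u + 2 \<le> q \<and> q \<le> g u + 1}"
    unfolding leaf_def children_eq[OF assms] by blast
  then show "g u \<le> hd u"
    by auto
qed (auto simp: leaf_def children_eq[OF assms])

section \<open>The labels of the children\<close>

text \<open>
  Every value above \<open>p\<close> is an ascent top because \<open>p\<close> stands first, and the bound \<open>p \<le> h u\<close> says
  that no ascent top of \<open>u\<close> lands at or below \<open>p\<close>.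
\<close>
lemma h_prepend:
  assumes "set u = {1..length u}" "1 \<le> p" "p < q" "q \<le> length u + 2" "p \<le> h u"
  shows "h (prepend p q u) = p + 1"
proof -
  let ?w = "prepend p q u"
  have tops: "ascent_tops ?w =
    skip p q ` ascent_tops u \<union> {y \<in> set ?w. p < y}"
    using assms(3) by (auto simp: prepend_def ascent_tops_Cons ascent_tops_map[OF strict_mono_skip])
  have "p \<le> v" if "v \<in> ascent_tops u" for v
    using assms(5) that by (auto simp: h_eq_Min)
  then have "p < y" if "y \<in> ascent_tops ?w" for y
    using that by (force simp: tops skip_def)
  moreover have "p + 1 \<in> ascent_tops ?w"
    using assms set_prepend[of u "length u" p q] by (simp add: tops)
  ultimately show ?thesis
    unfolding h_eq_Min using assms by (intro Min_eqI) fastforce+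
qed

text \<open>
  The old heads contribute \<open>g u + 2\<close>, since all of them lie above \<open>q\<close> after relabelling.  A new
  entry is a head exactly when some old ascent top lands below it.
\<close>
lemma g_prepend:
  assumes "p < q" "q \<le> g u + 1"
  shows "g (prepend p q u) =
    (if h u < p then p else if h u + 1 < q then q else g u + 2)"
proof -
  let ?f = "skip p q" and ?N = "length u"
  have q_le: "q \<le> ?N + 2"
    using assms g_le[of u] by simp
  have ex: "(\<exists>z \<in> ascent_tops u. z < c) \<longleftrightarrow> h u < c" if "c \<le> ?N + 1" for c
    using that by (auto simp: h_eq_Min Min_less_iff)
  have below_p: "(\<exists>z \<in> ascent_tops (q # map ?f u). z < p) \<longleftrightarrow> h u < p"
    using assms q_le ex[of p]
    by (auto simp: ascent_tops_Cons ascent_tops_map[OF strict_mono_skip] skip_less_iff bex_Un)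
  have below_q: "(\<exists>z \<in> ascent_tops (map ?f u). z < q) \<longleftrightarrow> h u < q - 1"
  proof -
    have "(\<exists>z \<in> ascent_tops (map ?f u). z < q) \<longleftrightarrow> (\<exists>z \<in> ascent_tops u. z < q - 1)"
    proof -
      have "Suc z < q \<longleftrightarrow> z < q - 1" for z
        by auto
      then show ?thesis
        using assms by (simp add: ascent_tops_map[OF strict_mono_skip] skip_less_iff)
    qed
    then show ?thesis
      using q_le ex[of "q - 1"] by simp
  qed
  \<comment> \<open>the default values \<open>?N + 1\<close> for \<open>u\<close> and \<open>?N + 3\<close> for the longer word correspond under \<open>?f\<close>\<close>
  have "Min (insert (?N + 3) (?f ` heads_312 u)) = Min (?f ` insert (?N + 1) (heads_312 u))"
  proof -
    have "?f (?N + 1) = ?N + 3"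
      using q_le assms by (simp add: skip_def)
    then show ?thesis
      by simp
  qed
  also have "\<dots> = ?f (g u)"
    unfolding g_eq_Min
    by (rule mono_Min_commute[symmetric]) (simp_all add: strict_mono_mono strict_mono_skip)
  also have "\<dots> = g u + 2"
    using assms by (simp add: skip_def)
  finally have base: "Min (insert (?N + 3) (?f ` heads_312 u)) = g u + 2" .
  have "heads_312 (prepend p q u) =
    ?f ` heads_312 u \<union> {v. v = q \<and> h u < q - 1} \<union> {v. v = p \<and> h u < p}"
    unfolding prepend_def heads_312_Cons below_p below_q heads_312_map[OF strict_mono_skip] ..
  moreover have "length (prepend p q u) + 1 = ?N + 3"
    by simp
  ultimately have "g (prepend p q u) = Min ({v. v = p \<and> h u < p} \<union>
    ({v. v = q \<and> h u < q - 1} \<union> insert (?N + 3) (?f ` heads_312 u)))"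
    by (simp only: g_eq_Min Un_insert_right Un_ac)
  moreover have Min_add: "Min ({v. v = x \<and> P} \<union> S) = (if P then min x (Min S) else Min S)"
    if "finite S" "S \<noteq> {}" for x P and S :: "nat set"
    using that by auto
  ultimately have "g (prepend p q u) =
    (let m = if h u < q - 1 then min q (g u + 2) else g u + 2 in if h u < p then min p m else m)"
    by (simp add: Min_add base del: Min_insert insert_iff Un_insert_right)
  then show ?thesis
    using assms by (auto simp: min_def)
qed

text \<open>
  The first entry is never an ascent top.  If an ascent top were smaller than it, the first
  entry would be the head of a 312, against \<open>hd u < g u\<close>.
\<close>
lemma hd_less_h:
  assumes u: "u \<in> alt_avoid (2 * n) [4, 3, 1, 2]" "n \<ge> 1" and "hd u < g u"
  shows "hd u < h u"
proof -
  obtain x xs where u_eq: "u = x # xs"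
    using length_alt_avoid[OF u(1)] u(2) by (cases u) auto
  have "x < z" if "z \<in> ascent_tops u" for z
  proof (rule ccontr)
    assume "\<not> x < z"
    then have z: "z \<in> ascent_tops xs" "z \<le> x"
      using that by (auto simp: u_eq ascent_tops_Cons)
    then have "z \<noteq> x"
      using u ascent_tops_subset by (auto simp: u_eq alt_avoid_iff)
    with z have "x \<in> heads_312 u"
      by (auto simp: u_eq heads_312_Cons intro!: bexI[of _ z])
    then have "g u \<le> x"
      by (simp add: g_eq_Min)
    with assms(3) show False
      by (simp add: u_eq)
  qed
  moreover have "x < length u + 1"
  proof -
    have "x \<in> set u"
      by (simp add: u_eq)
    then show ?thesis
      using u(1) length_alt_avoid[OF u(1)] by (simp add: alt_avoid_iff)
  qed
  ultimately show ?thesis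
    by (simp add: h_eq_Min) (simp add: u_eq)
qed

lemma card_increasing_pairs:
  "card {(p, q). a < p \<and> p < q \<and> q \<le> a + d} = d choose 2" for a d :: nat
proof (induction d)
  case 0
  have "{(p, q). a < p \<and> p < q \<and> q \<le> a + 0} = {}"
    by auto
  then show ?case
    by (simp only: card.empty) simp
next
  case (Suc d)
  let ?S = "{(p, q). a < p \<and> p < q \<and> q \<le> a + d}"
  have "{(p, q). a < p \<and> p < q \<and> q \<le> a + Suc d} = ?S \<union> {a<..a + d} \<times> {a + Suc d}"
    by auto
  moreover have "finite ?S"
    by (rule finite_subset[of _ "{..a + d} \<times> {..a + d}"]) auto
  moreover have "?S \<inter> {a<..a + d} \<times> {a + Suc d} = {}"
    by auto
  ultimately have "card {(p, q). a < p \<and> p < q \<and> q \<le> a + Suc d} = card ?S + d"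
    by (simp add: card_Un_disjoint)
  also have "\<dots> = Suc d choose 2"
    using Suc.IH by (simp add: numeral_2_eq_2)
  finally show ?case .
qed

theorem theorem4p4:
  fixes n a b :: nat and u :: "nat list"
  assumes "n \<ge> 1"
    and "u \<in> alt_avoid (2 * n) [4, 3, 1, 2]"
    and "label u = (a, b)"
    and "internal_vertex u"
  shows "card {w \<in> children u. leaf w} = (b - a + 1) choose 2 \<and>
    label ` {w \<in> children u. internal_vertex w} =
      {(x, y). 2 \<le> x \<and> x \<le> a + 1 \<and> a + 2 \<le> y \<and> y \<le> b + 2}"
proof -
  have ab: "a = h u" "b = g u" and not_leaf: "\<not> leaf u"
    using assms(3,4) by (auto simp: label_def internal_vertex_def leaf_def)
  have len: "length u = 2 * n"
    using assms(2) by (rule length_alt_avoid)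
  then have ne: "u \<noteq> []"
    using assms(1) by auto
  define r where "r = hd u"
  have "r < b"
    using leaf_iff[OF assms(2) ne] not_leaf by (simp add: ab r_def)
  then have "r < a"
    using hd_less_h[OF assms(2,1)] by (simp add: ab r_def)
  have "a \<le> b"
    using h_le_g by (simp add: ab)
  have "b \<le> 2 * n + 1"
    using g_le[of u] by (simp add: ab len)
  define D where "D = {(p, q). 1 \<le> p \<and> p < q \<and> r + 2 \<le> q \<and> q \<le> b + 1}"
  define F where "F = (\<lambda>(p, q). prepend p q u)"
  have kids: "children u = F ` D"
    using children_eq[OF assms(2) ne] by (simp add: F_def D_def ab r_def)
  have leaf_F: "leaf (F (p, q)) \<longleftrightarrow> a < p" if D: "(p, q) \<in> D" for p q
  proof -
    have "F (p, q) \<in> children u"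
      using D kids by blast
    then have "F (p, q) \<in> alt_avoid (2 * n + 2) [4, 3, 1, 2]"
      by (simp add: children_def len)
    moreover have "F (p, q) \<noteq> []"
      by (simp add: F_def prepend_def)
    ultimately have "leaf (F (p, q)) \<longleftrightarrow> g (prepend p q u) \<le> p"
      by (simp add: leaf_iff F_def)
    also have "\<dots> \<longleftrightarrow> a < p"
      using D \<open>a \<le> b\<close> by (auto simp: D_def g_prepend ab)
    finally show ?thesis .
  qed
  have label_F: "label (F (p, q)) = (p + 1, if a + 1 < q then q else b + 2)"
    if D: "(p, q) \<in> D" and "p \<le> a" for p q
  proof -
    have "set u = {1..length u}"
      using assms(2) len by (simp add: alt_avoid_iff)
    then have "h (prepend p q u) = p + 1"
      using that \<open>b \<le> 2 * n + 1\<close> by (intro h_prepend) (auto simp: D_def ab len)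
    moreover have "g (prepend p q u) = (if a + 1 < q then q else b + 2)"
      using that by (simp add: D_def g_prepend ab)
    ultimately show ?thesis
      using leaf_F[OF D] \<open>p \<le> a\<close> by (simp add: label_def F_def)
  qed

  have "{w \<in> children u. leaf w} = F ` {(p, q). a < p \<and> p < q \<and> q \<le> a + (b - a + 1)}"
  proof -
    have "{w \<in> children u. leaf w} = F ` {x \<in> D. leaf (F x)}"
      by (auto simp: kids)
    also have "{x \<in> D. leaf (F x)} = {(p, q). a < p \<and> p < q \<and> q \<le> a + (b - a + 1)}"
      using leaf_F \<open>r < a\<close> \<open>a \<le> b\<close> by (auto simp: D_def)
    finally show ?thesis .
  qed
  moreover have "inj F"
    by (auto simp: inj_def F_def prepend_inject)
  ultimately have "card {w \<in> children u. leaf w} = (b - a + 1) choose 2"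
    by (simp add: card_image inj_on_subset card_increasing_pairs)

  moreover have "label ` {w \<in> children u. internal_vertex w} =
    {(x, y). 2 \<le> x \<and> x \<le> a + 1 \<and> a + 2 \<le> y \<and> y \<le> b + 2}" (is "?L = ?R")
  proof -
    have "{w \<in> children u. internal_vertex w} = F ` {(p, q) \<in> D. p \<le> a}"
      using leaf_F by (force simp: kids internal_vertex_def leaf_def)
    then have L: "?L = (\<lambda>(p, q). (p + 1, if a + 1 < q then q else b + 2)) ` {(p, q) \<in> D. p \<le> a}"
      using label_F by (force simp: image_image intro!: image_cong)
    show ?thesis
    proof
      show "?L \<subseteq> ?R"
        unfolding L using \<open>a \<le> b\<close> by (auto simp: D_def)
      show "?R \<subseteq> ?L"
      proof clarify
        fix x y assume xy: "2 \<le> x" "x \<le> a + 1" "a + 2 \<le> y" "y \<le> b + 2"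
        \<comment> \<open>\<open>a + 1\<close> is too small to become a head, and it is admissible because \<open>r < a\<close>\<close>
        define q where "q = (if y = b + 2 then a + 1 else y)"
        have "(x - 1, q) \<in> {(p, q) \<in> D. p \<le> a}"
          using xy \<open>r < a\<close> \<open>a \<le> b\<close> by (auto simp: D_def q_def)
        moreover have "(x, y) = (x - 1 + 1, if a + 1 < q then q else b + 2)"
          using xy by (auto simp: q_def)
        ultimately show "(x, y) \<in> ?L"
          unfolding L by (force simp del: add_is_1)
      qed
    qed
  qed
  ultimately show ?thesis
    by blast
qed

end
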